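(* Let $A=(a_i)_{i\ge1}$ be a nondecreasing sequence of positive integers that remains complete after every deletion of two occurrences. If $D$ is any finite set of occurrences such that $A\setminus D$ is complete, then there is an occurrence not in $D$ such that, with $D'$ denoting $D$ enlarged by this occurrence, $A\setminus D'$ is complete. Consequently, for every nonnegative integer $r$, some deletion of $r$ occurrences from $A$ leaves a complete sequence.
   Context: For a sequence $A$ of integers, $\mathrm{FS}(A)$ is the set of sums of finite selections of its terms, including the empty sum $0$; each occurrence (index) may be selected at most once, and repeated values count as separate occurrences. The sequence is complete if $\mathrm{FS}(A)$ contains every sufficiently large integer. An occurrence is a term at a specific index; for a set $D$ of occurrences, $A\setminus D$ is the sequence obtained by removing exactly those occurrences. *)

theory Defs
  imports Main
begin

text \<open>
  Occurrences of a sequence \<open>a\<close> are its indices. The subsequence of \<open>a\<close> on an index set \<open>I\<close> is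
  represented by the pair \<open>a\<close>, \<open>I\<close> without renumbering, so the sequence itself is given by
  \<open>UNIV\<close> and the sequence with the occurrences in \<open>D\<close> removed by \<open>UNIV - D\<close>.
\<close>

definition FS :: "(nat \<Rightarrow> int) \<Rightarrow> nat set \<Rightarrow> int set" where
  "FS a I = {(\<Sum>i\<in>F. a i) | F. finite F \<and> F \<subseteq> I}"

definition complete_seq :: "(nat \<Rightarrow> int) \<Rightarrow> nat set \<Rightarrow> bool" where
  "complete_seq a I \<longleftrightarrow> (\<exists>N. \<forall>n\<ge>N. n \<in> FS a I)"

end

theory Submission
  imports Defs
begin

text \<open>
  If \<open>a\<close> is bounded, it is eventually constant, and any late occurrence \<open>j\<close> can be deleted: a sum
  that uses \<open>j\<close> can use another late occurrence instead.

  Let \<open>a\<close> be unbounded, let \<open>I\<close> be the complement of \<open>D\<close>, let \<open>N > 0\<close> be a bound from which on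
  all integers are sums over \<open>I\<close>, and let \<open>T n\<close> (\<open>head n\<close> below) be the sum of the terms in \<open>I\<close>
  before index \<open>n\<close>. Two facts carry the proof.

  \<^item> Slack (\<open>head_exceeds_next_term\<close>): \<open>T n - a n\<close> tends to infinity. If a large term \<open>a y\<close> is
    deleted, then \<open>a n - 1\<close> must still be a sum for large \<open>n\<close>, and only terms before \<open>n\<close> other
    than \<open>a y\<close> are available.
  \<^item> Fullness (\<open>heads_full\<close>): for some \<open>M\<close> and all \<open>n\<close>, the terms in \<open>I\<close> before \<open>n\<close> represent
    every integer between \<open>N\<close> and \<open>T n - M\<close>.

  Given fullness, choose \<open>y\<close> with \<open>a y\<close> at least \<open>N + M\<close> plus the sum over \<open>D\<close>, and any \<open>j\<close>
  beyond \<open>y\<close> and \<open>D\<close>. For large \<open>x\<close>, write \<open>x - N = g + f\<close> as a sum without \<open>y\<close> and \<open>j\<close>, with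
  \<open>g\<close> from terms before \<open>j\<close> and \<open>f\<close> from terms after \<open>j\<close>. The missing \<open>a y\<close> makes
  \<open>g + N \<le> T j - M\<close>, so \<open>g + N\<close> can be represented anew by the terms in \<open>I\<close> before \<open>j\<close>, and
  \<open>x = (g + N) + f\<close> avoids both \<open>D\<close> and \<open>j\<close>. This is where two deletions are used: \<open>j\<close> itself, and
  \<open>y\<close> to absorb the constants.

  Fullness is proved by contradiction. Terms before \<open>n\<close> represent all of \<open>[N, a n)\<close>, since no other
  terms fit. So if \<open>z\<close> is not represented, subtracting terms from the top downwards always
  leaves an unrepresented remainder, which is below \<open>N\<close> or still exceeds the next term; the descent
  ends at an unrepresented \<open>a l + s\<close> with \<open>0 \<le> s < N\<close> (\<open>greedy_descent\<close>). Completeness represents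
  \<open>a l + s\<close> somehow, hence by means of a later term \<open>a i\<close> with \<open>a l < a i \<le> a l + s\<close>
  (\<open>near_twin\<close>). This \<open>a i\<close> must be among the subtracted terms, and subtracting \<open>a l\<close> in its place
  raises the remainder by at least 1 and less than \<open>N\<close>. The slack allows the descent to be resumed
  among terms smaller by at least \<open>N\<close>, so the exchanges do not interfere. After \<open>N\<close> of them
  (\<open>accumulate_swaps\<close>) the remainder is \<open>a l + t\<close> with \<open>N \<le> t < a l\<close>, and such a \<open>t\<close> is represented
  by the terms before \<open>l\<close>: so \<open>z\<close> was represented after all.
\<close>

section \<open>Subset sums\<close>

lemma FS_mono: "x \<in> FS a I \<Longrightarrow> I \<subseteq> J \<Longrightarrow> x \<in> FS a J"
  unfolding FS_def by blast

lemma FS_I: "finite F \<Longrightarrow> F \<subseteq> I \<Longrightarrow> (\<Sum>i\<in>F. a i) \<in> FS a I"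
  unfolding FS_def by blast

lemma FS_E:
  assumes "x \<in> FS a I"
  obtains F where "finite F" "F \<subseteq> I" "x = (\<Sum>i\<in>F. a i)"
  using assms unfolding FS_def by blast

lemma FS_add_disjoint:
  assumes "x \<in> FS a I" "y \<in> FS a J" "I \<inter> J = {}" "I \<union> J \<subseteq> K"
  shows "x + y \<in> FS a K"
proof -
  obtain F where F: "finite F" "F \<subseteq> I" "x = (\<Sum>i\<in>F. a i)" using assms(1) by (rule FS_E)
  obtain G where G: "finite G" "G \<subseteq> J" "y = (\<Sum>i\<in>G. a i)" using assms(2) by (rule FS_E)
  have "x + y = (\<Sum>i\<in>F \<union> G. a i)"
    using F G assms(3) by (subst sum.union_disjoint) auto
  moreover have "F \<union> G \<subseteq> K" using F G assms(4) by blast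
  ultimately show ?thesis using F(1) G(1) FS_I[of "F \<union> G" K a] by simp
qed

lemma complete_seq_mono: "complete_seq a I \<Longrightarrow> I \<subseteq> J \<Longrightarrow> complete_seq a J"
  unfolding complete_seq_def using FS_mono by blast

section \<open>Initial segments of a complete sequence with slack\<close>

locale slack_complete =
  fixes a :: "nat \<Rightarrow> int" and I :: "nat set" and N :: int
  assumes mono_a: "mono a"
    and pos: "\<And>i. 0 < a i"
    and unbounded: "\<And>K. \<exists>n. K \<le> a n"
    and N_pos: "0 < N"
    and rep: "\<And>x. N \<le> x \<Longrightarrow> x \<in> FS a I"
    and slack: "\<And>K. \<exists>p. \<forall>n\<ge>p. a n + K \<le> (\<Sum>i\<in>I \<inter> {..<n}. a i)"
begin

definition head :: "nat \<Rightarrow> int" where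
  "head n = (\<Sum>i\<in>I \<inter> {..<n}. a i)"

lemma less_index: "a i < a j \<Longrightarrow> i < j"
  using mono_a by (metis leD leI monoD)

lemma head_Suc: "head (Suc n) = head n + (if n \<in> I then a n else 0)"
  unfolding head_def lessThan_Suc by auto

lemma head_mono: "m \<le> n \<Longrightarrow> head m \<le> head n"
  unfolding head_def using pos
  by (intro sum_mono2) (auto simp: less_imp_le)

lemma sum_member_le:
  assumes "finite F" "i \<in> F" shows "a i \<le> (\<Sum>i\<in>F. a i)"
  using assms pos by (intro member_le_sum) (auto simp: less_imp_le)

lemma rep_below:
  assumes "N \<le> x" "x < a n"
  shows "x \<in> FS a (I \<inter> {..<n})"
proof -
  obtain F where F: "finite F" "F \<subseteq> I" "x = (\<Sum>i\<in>F. a i)"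
    using rep[OF assms(1)] by (rule FS_E)
  have "i < n" if "i \<in> F" for i
    using sum_member_le[OF F(1) that] F(3) assms(2) less_index by fastforce
  then have "F \<subseteq> I \<inter> {..<n}" using F(2) by blast
  then show ?thesis using F FS_I by blast
qed

text \<open>
  All terms in \<open>I\<close> from \<open>n - 1\<close> downwards are subtracted from \<open>z\<close>. An unrepresented remainder in
  \<open>[N, a k)\<close> would contradict \<open>rep_below\<close>, so no subtraction can overshoot; \<open>l\<close> is the index
  whose subtraction first leaves a remainder \<open>s\<close> below \<open>N\<close>. The second formula for \<open>z\<close> shows that
  \<open>l\<close> is large when \<open>z\<close> is far below \<open>head n\<close>.
\<close>

lemma greedy_descent:
  assumes "z \<notin> FS a (I \<inter> {..<n})" "N \<le> z" "z < head n + N"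
  shows "\<exists>l s. l < n \<and> l \<in> I \<and> 0 \<le> s \<and> s < N \<and> z = (\<Sum>i\<in>I \<inter> {l<..<n}. a i) + a l + s
    \<and> z = head n - head l + s \<and> N \<le> a l + s \<and> a l + s \<notin> FS a (I \<inter> {..l})"
  using assms
proof (induction n arbitrary: z)
  case 0
  then show ?case by (simp add: head_def)
next
  case (Suc n)
  show ?case
  proof (cases "n \<in> I")
    case False
    have lt: "I \<inter> {..<Suc n} = I \<inter> {..<n}" using False by (auto simp: less_Suc_eq)
    have iv: "I \<inter> {l<..<Suc n} = I \<inter> {l<..<n}" for l using False by (auto simp: less_Suc_eq)
    have hd: "head (Suc n) = head n" using False by (simp add: head_Suc)
    show ?thesis
      using Suc.IH[of z] Suc.prems unfolding lt iv hd by (meson less_SucI)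
  next
    case True
    have hd: "head (Suc n) = head n + a n" using True by (simp add: head_Suc)
    have "z \<notin> FS a (I \<inter> {..<n})"
      using Suc.prems(1) FS_mono[of z a "I \<inter> {..<n}" "I \<inter> {..<Suc n}"] by fastforce
    then have an: "a n \<le> z" using rep_below[OF Suc.prems(2), of n] by linarith
    have single: "a n \<in> FS a {n}" using FS_I[of "{n}" "{n}" a] by simp
    have w: "z - a n \<notin> FS a (I \<inter> {..<n})"
    proof
      assume "z - a n \<in> FS a (I \<inter> {..<n})"
      then have "z - a n + a n \<in> FS a (I \<inter> {..<Suc n})"
        using True by (intro FS_add_disjoint[OF _ single]) auto
      then show False using Suc.prems(1) by simp
    qed
    show ?thesis
    proof (cases "z - a n < N")
      case True
      have "{n<..<Suc n} = {}" by auto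
      moreover have "{..<Suc n} = {..n}" by auto
      ultimately show ?thesis
        using \<open>n \<in> I\<close> True an Suc.prems hd
        by (intro exI[of _ n] exI[of _ "z - a n"]) auto
    next
      case False
      then obtain l s where ls: "l < n" "l \<in> I" "0 \<le> s" "s < N"
        "z - a n = (\<Sum>i\<in>I \<inter> {l<..<n}. a i) + a l + s"
        "z - a n = head n - head l + s" "N \<le> a l + s" "a l + s \<notin> FS a (I \<inter> {..l})"
        using Suc.IH[OF w] Suc.prems(3) hd by auto
      have "I \<inter> {l<..<Suc n} = insert n (I \<inter> {l<..<n})" using ls(1) True by (auto simp: less_Suc_eq)
      then have "(\<Sum>i\<in>I \<inter> {l<..<Suc n}. a i) = a n + (\<Sum>i\<in>I \<inter> {l<..<n}. a i)" by simp
      then show ?thesis using ls hd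
        by (intro exI[of _ l] exI[of _ s]) auto
    qed
  qed
qed

text \<open>
  A descent that can be iterated. It stops at an unrepresented \<open>a l + s\<close>, and the next descent is
  to start at \<open>m\<close>, the first index of a term exceeding \<open>a l - N\<close>: every term within \<open>N\<close> of a term
  before \<open>m\<close> then has an index below \<open>l\<close>. Although the terms between \<open>m\<close> and \<open>l\<close> may have a large
  sum, giving them up is harmless: \<open>a l + s\<close> is within \<open>2 * N\<close> of \<open>a m\<close>, hence far below
  \<open>head m\<close> by the slack at \<open>m\<close>.
\<close>

lemma descent_step:
  "\<exists>M. \<forall>n z. z \<notin> FS a (I \<inter> {..<n}) \<longrightarrow> N \<le> z \<longrightarrow> z \<le> head n - M \<longrightarrow>
    (\<exists>l s m. l < n \<and> l \<in> I \<and> L \<le> l \<and> 0 \<le> s \<and> s < N \<and> N \<le> a l \<and>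
      z = (\<Sum>i\<in>I \<inter> {l<..<n}. a i) + (a l + s) \<and> a l + s \<notin> FS a (I \<inter> {..l}) \<and>
      m \<le> l \<and> (\<forall>p<m. \<forall>i. a i < a p + N \<longrightarrow> i < l) \<and> a l + s \<le> head m - K)"
proof -
  obtain p where p: "\<And>n. p \<le> n \<Longrightarrow> a n + (K + 2 * N) \<le> head n"
    using slack[of "K + 2 * N"] unfolding head_def by blast
  obtain r where r: "a p + N \<le> a r" using unbounded by blast
  define b where "b = max r L"
  have head_nonneg: "0 \<le> head n" for n
    unfolding head_def using pos by (intro sum_nonneg) (simp add: less_imp_le)
  show ?thesis
  proof (intro exI[of _ "head b + 1"] allI impI)
    fix n z
    assume z: "z \<notin> FS a (I \<inter> {..<n})" "N \<le> z" "z \<le> head n - (head b + 1)"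
    have "z < head n + N" using z(3) head_nonneg[of b] N_pos by linarith
    from greedy_descent[OF z(1,2) this] obtain l s where ls: "l < n" "l \<in> I" "0 \<le> s" "s < N"
      "z = (\<Sum>i\<in>I \<inter> {l<..<n}. a i) + a l + s" "z = head n - head l + s"
      "a l + s \<notin> FS a (I \<inter> {..l})" by blast
    have "head b < head l" using ls(3,6) z(3) by linarith
    then have bl: "b \<le> l" using head_mono[of l b] by linarith
    have "a r \<le> a l" using bl monoD[OF mono_a, of r l] unfolding b_def by simp
    then have al: "a p + N \<le> a l" using r by linarith
    define m where "m = (LEAST i. a l - N < a i)"
    have m: "a l - N < a m" unfolding m_def using N_pos by (intro LeastI[of "\<lambda>i. a l - N < a i" l]) simp
    have ml: "m \<le> l" unfolding m_def using N_pos by (intro Least_le) simp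
    have below: "a q \<le> a l - N" if "q < m" for q
      using not_less_Least[OF that[unfolded m_def]] by simp
    have "p < m" using less_index[of p m] m al by linarith
    then have "a l + s \<le> head m - K" using p[of m] m ls(4) by simp
    moreover have "i < l" if "q < m" "a i < a q + N" for q i
      using below[OF that(1)] that(2) less_index[of i l] by linarith
    moreover have "N \<le> a l" using al pos[of p] by linarith
    ultimately show "\<exists>l s m. l < n \<and> l \<in> I \<and> L \<le> l \<and> 0 \<le> s \<and> s < N \<and> N \<le> a l \<and>
      z = (\<Sum>i\<in>I \<inter> {l<..<n}. a i) + (a l + s) \<and> a l + s \<notin> FS a (I \<inter> {..l}) \<and>
      m \<le> l \<and> (\<forall>p<m. \<forall>i. a i < a p + N \<longrightarrow> i < l) \<and> a l + s \<le> head m - K"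
      using ls bl ml unfolding b_def
      by (intro exI[of _ l] exI[of _ s] exI[of _ m]) (auto simp: add.assoc)
  qed
qed

text \<open>
  As \<open>a l + s\<close> is represented in \<open>I\<close> but not up to index \<open>l\<close>, a representation uses some \<open>i > l\<close>; what
  remains is at most \<open>s < N \<le> a l\<close> and so comes from terms before \<open>l\<close>. If \<open>a i = a l\<close>, then \<open>l\<close>
  could replace \<open>i\<close>.
\<close>

lemma near_twin:
  assumes "l \<in> I" "N \<le> a l" "0 \<le> s" "s < N" "a l + s \<notin> FS a (I \<inter> {..l})"
  obtains i G where "i \<in> I" "l < i" "a l < a i" "a i \<le> a l + s"
    "finite G" "G \<subseteq> I \<inter> {..<l}" "a l + s = a i + (\<Sum>g\<in>G. a g)"
proof -
  obtain H where H: "finite H" "H \<subseteq> I" "a l + s = (\<Sum>i\<in>H. a i)"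
    using rep[of "a l + s"] assms(2,3) unfolding FS_def by auto
  have "\<not> H \<subseteq> {..l}" using FS_I[of H "I \<inter> {..l}" a] H assms(5) by auto
  then obtain i where i: "i \<in> H" "l < i" by (meson atMost_iff not_le subsetI)
  define G where "G = H - {i}"
  have eq: "a l + s = a i + (\<Sum>g\<in>G. a g)"
    unfolding G_def using H i(1) by (simp add: sum.remove)
  have li: "a l \<le> a i" using mono_a i(2) by (simp add: monoD)
  have fin: "finite G" unfolding G_def using H(1) by simp
  have "g < l" if "g \<in> G" for g
    using sum_member_le[OF fin that] eq li assms(2,4) less_index[of g l] by linarith
  then have G: "G \<subseteq> I \<inter> {..<l}" unfolding G_def using H(2) by blast
  have "a i \<noteq> a l"
  proof
    assume "a i = a l"
    then have "a l + s = (\<Sum>g\<in>insert l G. a g)"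
      using eq fin G by (subst sum.insert) auto
    moreover have "insert l G \<subseteq> I \<inter> {..l}" using G assms(1) by auto
    ultimately show False using assms(5) FS_I[of "insert l G" "I \<inter> {..l}" a] fin by simp
  qed
  moreover have "0 \<le> (\<Sum>g\<in>G. a g)" using pos by (intro sum_nonneg) (simp add: less_imp_le)
  ultimately show ?thesis using that[of i G] i H(2) li eq fin G by auto
qed

text \<open>
  The remainder \<open>a l + t\<close> after \<open>q\<close> exchanges of a subtracted term for its smaller near twin. The
  bound \<open>v\<close> is needed for the induction: a later descent starts at some \<open>m \<le> v\<close>, but its
  twin may have an index between \<open>m\<close> and \<open>v\<close>, and \<open>z\<close> must be unrepresented there as well for the twin to be
  one of the subtracted terms.
\<close>

lemma accumulate_swaps:
  "\<exists>M. \<forall>n v z. n \<le> v \<longrightarrow> (\<forall>p<n. \<forall>i. a i < a p + N \<longrightarrow> i < v) \<longrightarrow>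
     z \<notin> FS a (I \<inter> {..<v}) \<longrightarrow> N \<le> z \<longrightarrow> z \<le> head n - M \<longrightarrow>
     (\<exists>l F t. l < n \<and> l \<in> I \<and> L \<le> l \<and> finite F \<and> F \<subseteq> I \<inter> {l<..<n} \<and>
        z = (\<Sum>i\<in>F. a i) + (a l + t) \<and> int q \<le> t \<and> t < (int q + 1) * N)"
proof (induction q)
  case 0
  obtain M where M: "\<And>n z. z \<notin> FS a (I \<inter> {..<n}) \<Longrightarrow> N \<le> z \<Longrightarrow> z \<le> head n - M \<Longrightarrow>
    (\<exists>l s. l < n \<and> l \<in> I \<and> L \<le> l \<and> 0 \<le> s \<and> s < N \<and>
      z = (\<Sum>i\<in>I \<inter> {l<..<n}. a i) + (a l + s))"
    using descent_step[of L 0] by blast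
  show ?case
  proof (intro exI[of _ M] allI impI)
    fix n v z
    assume "n \<le> v" "z \<notin> FS a (I \<inter> {..<v})" and z: "N \<le> z" "z \<le> head n - M"
    then have "z \<notin> FS a (I \<inter> {..<n})"
      using FS_mono[of z a "I \<inter> {..<n}" "I \<inter> {..<v}"] by fastforce
    from M[OF this z] obtain l s where "l < n" "l \<in> I" "L \<le> l" "0 \<le> s" "s < N"
      "z = (\<Sum>i\<in>I \<inter> {l<..<n}. a i) + (a l + s)" by blast
    then show "\<exists>l F t. l < n \<and> l \<in> I \<and> L \<le> l \<and> finite F \<and> F \<subseteq> I \<inter> {l<..<n} \<and>
        z = (\<Sum>i\<in>F. a i) + (a l + t) \<and> int 0 \<le> t \<and> t < (int 0 + 1) * N"
      by (intro exI[of _ l] exI[of _ "I \<inter> {l<..<n}"] exI[of _ s]) auto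
  qed
next
  case (Suc q)
  then obtain K where K: "\<And>n v z. n \<le> v \<Longrightarrow> (\<forall>p<n. \<forall>i. a i < a p + N \<longrightarrow> i < v) \<Longrightarrow>
     z \<notin> FS a (I \<inter> {..<v}) \<Longrightarrow> N \<le> z \<Longrightarrow> z \<le> head n - K \<Longrightarrow>
     (\<exists>l F t. l < n \<and> l \<in> I \<and> L \<le> l \<and> finite F \<and> F \<subseteq> I \<inter> {l<..<n} \<and>
        z = (\<Sum>i\<in>F. a i) + (a l + t) \<and> int q \<le> t \<and> t < (int q + 1) * N)"
    by blast
  obtain M where M: "\<And>n z. z \<notin> FS a (I \<inter> {..<n}) \<Longrightarrow> N \<le> z \<Longrightarrow> z \<le> head n - M \<Longrightarrow>
    (\<exists>l s m. l < n \<and> l \<in> I \<and> L \<le> l \<and> 0 \<le> s \<and> s < N \<and> N \<le> a l \<and>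
      z = (\<Sum>i\<in>I \<inter> {l<..<n}. a i) + (a l + s) \<and> a l + s \<notin> FS a (I \<inter> {..l}) \<and>
      m \<le> l \<and> (\<forall>p<m. \<forall>i. a i < a p + N \<longrightarrow> i < l) \<and> a l + s \<le> head m - K)"
    using descent_step[of L K] by blast
  show ?case
  proof (intro exI[of _ M] allI impI)
    fix n v z
    assume nv: "n \<le> v" and near: "\<forall>p<n. \<forall>i. a i < a p + N \<longrightarrow> i < v"
      and zv: "z \<notin> FS a (I \<inter> {..<v})" and z: "N \<le> z" "z \<le> head n - M"
    have "z \<notin> FS a (I \<inter> {..<n})"
      using zv nv FS_mono[of z a "I \<inter> {..<n}" "I \<inter> {..<v}"] by fastforce
    from M[OF this z] obtain l s m where l: "l < n" "l \<in> I" "L \<le> l" "0 \<le> s" "s < N" "N \<le> a l"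
      and zeq: "z = (\<Sum>i\<in>I \<inter> {l<..<n}. a i) + (a l + s)"
      and nrep: "a l + s \<notin> FS a (I \<inter> {..l})"
      and m: "m \<le> l" "\<forall>p<m. \<forall>i. a i < a p + N \<longrightarrow> i < l" "a l + s \<le> head m - K" by blast
    obtain i G where i: "i \<in> I" "l < i" "a l < a i" "a i \<le> a l + s"
      and G: "finite G" "G \<subseteq> I \<inter> {..<l}" "a l + s = a i + (\<Sum>g\<in>G. a g)"
      using near_twin[OF l(2,6,4,5) nrep] by metis
    have iv: "i < v" using near l(1,5) i(4) by (meson add_strict_left_mono order_le_less_trans)
    \<comment> \<open>Otherwise \<open>i\<close> is not among the subtracted terms, and adding them to the representation of
      \<open>a l + s\<close> through \<open>i\<close> represents \<open>z\<close> below \<open>v\<close>.\<close>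
    have "i < n"
    proof (rule ccontr)
      assume "\<not> i < n"
      have "(\<Sum>j\<in>insert i G. a j) = a l + s"
        using G i(2) by (subst sum.insert) auto
      then have "z = (\<Sum>j\<in>(I \<inter> {l<..<n}) \<union> insert i G. a j)"
        using zeq G(1,2) \<open>\<not> i < n\<close> by (subst sum.union_disjoint) auto
      moreover have "(I \<inter> {l<..<n}) \<union> insert i G \<subseteq> I \<inter> {..<v}"
        using G(2) i(1) iv nv l(1) by auto
      ultimately show False
        using zv FS_I[of "(I \<inter> {l<..<n}) \<union> insert i G" "I \<inter> {..<v}" a] G(1) by auto
    qed
    have "a l + s \<notin> FS a (I \<inter> {..<l})"
      using nrep FS_mono[of "a l + s" a "I \<inter> {..<l}" "I \<inter> {..l}"] by fastforce
    from K[OF m(1,2) this _ m(3)] l(4,6) obtain l' F t where l': "l' < m" "l' \<in> I" "L \<le> l'"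
      and F: "finite F" "F \<subseteq> I \<inter> {l'<..<m}" "a l + s = (\<Sum>i\<in>F. a i) + (a l' + t)"
      and t: "int q \<le> t" "t < (int q + 1) * N" by auto
    \<comment> \<open>Above \<open>l\<close>, the subtracted term \<open>a i\<close> is exchanged for \<open>a l\<close>; the difference goes into the
      remainder of the lower descent.\<close>
    define E where "E = (I \<inter> {l<..<n}) - {i}"
    have E: "(\<Sum>j\<in>I \<inter> {l<..<n}. a j) = a i + (\<Sum>j\<in>E. a j)"
      unfolding E_def using i(1,2) \<open>i < n\<close> by (intro sum.remove) auto
    have "(\<Sum>j\<in>E \<union> insert l F. a j) = (\<Sum>j\<in>E. a j) + (\<Sum>j\<in>insert l F. a j)"
      using F m(1) unfolding E_def by (intro sum.union_disjoint) auto
    also have "(\<Sum>j\<in>insert l F. a j) = a l + (\<Sum>j\<in>F. a j)"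
      using F m(1) by (intro sum.insert) auto
    finally have "z = (\<Sum>j\<in>E \<union> insert l F. a j) + (a l' + (t + (a i - a l)))"
      using zeq E F(3) by simp
    moreover have "E \<union> insert l F \<subseteq> I \<inter> {l'<..<n}"
      using F(2) l(1,2) l'(1) m(1) unfolding E_def by auto
    moreover have "finite (E \<union> insert l F)" using F(1) unfolding E_def by simp
    moreover have "t + (a i - a l) < (int (Suc q) + 1) * N"
      using t(2) i(4) l(5) by (simp add: algebra_simps)
    moreover have "int (Suc q) \<le> t + (a i - a l)" using t(1) i(3) by simp
    moreover have "l' < n" using l'(1) m(1) l(1) by simp
    ultimately show "\<exists>l F t. l < n \<and> l \<in> I \<and> L \<le> l \<and> finite F \<and> F \<subseteq> I \<inter> {l<..<n} \<and>
        z = (\<Sum>i\<in>F. a i) + (a l + t) \<and> int (Suc q) \<le> t \<and> t < (int (Suc q) + 1) * N"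
      using l'(2,3)
      by (intro exI[of _ l'] exI[of _ "E \<union> insert l F"] exI[of _ "t + (a i - a l)"] conjI)
  qed
qed

text \<open>
  After \<open>N\<close> exchanges the offset \<open>t\<close> lies in \<open>[N, (N + 1) * N)\<close>. For \<open>a l\<close> beyond this range \<open>t\<close>
  itself is represented before \<open>l\<close>.
\<close>

lemma heads_full: "\<exists>M. \<forall>n z. N \<le> z \<longrightarrow> z \<le> head n - M \<longrightarrow> z \<in> FS a (I \<inter> {..<n})"
proof -
  obtain L where L: "(N + 1) * N \<le> a L" using unbounded by blast
  obtain K where K: "\<And>n v z. n \<le> v \<Longrightarrow> (\<forall>p<n. \<forall>i. a i < a p + N \<longrightarrow> i < v) \<Longrightarrow>
     z \<notin> FS a (I \<inter> {..<v}) \<Longrightarrow> N \<le> z \<Longrightarrow> z \<le> head n - K \<Longrightarrow>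
     (\<exists>l F t. l < n \<and> l \<in> I \<and> L \<le> l \<and> finite F \<and> F \<subseteq> I \<inter> {l<..<n} \<and>
        z = (\<Sum>i\<in>F. a i) + (a l + t) \<and> N \<le> t \<and> t < (N + 1) * N)"
    using accumulate_swaps[of L "nat N"] N_pos unfolding int_nat_eq by (simp only: less_imp_le if_True) blast
  \<comment> \<open>This yields representations only below \<open>v\<close>, that is, by terms that may exceed those before
    \<open>n\<close> by up to \<open>N\<close>. One further descent, from \<open>n\<close> to \<open>l\<close>, removes this defect below.\<close>
  have near_full: False if *: "n \<le> v" "\<forall>p<n. \<forall>i. a i < a p + N \<longrightarrow> i < v"
    "z \<notin> FS a (I \<inter> {..<v})" "N \<le> z" "z \<le> head n - K" for n v z
  proof -
    from K[OF *] obtain l F t where l: "l < n" "l \<in> I" "L \<le> l"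
      and F: "finite F" "F \<subseteq> I \<inter> {l<..<n}" "z = (\<Sum>i\<in>F. a i) + (a l + t)"
      and t: "N \<le> t" "t < (N + 1) * N" by blast
    have "a L \<le> a l" using l(3) mono_a by (simp add: monoD)
    then have "t \<in> FS a (I \<inter> {..<l})" using rep_below[OF t(1), of l] t(2) L by linarith
    moreover have "(\<Sum>i\<in>insert l F. a i) \<in> FS a (I \<inter> {l..<n})"
      using F l by (intro FS_I) auto
    moreover have "(\<Sum>i\<in>insert l F. a i) = a l + (\<Sum>i\<in>F. a i)"
      using F by (intro sum.insert) auto
    ultimately have "t + (a l + (\<Sum>i\<in>F. a i)) \<in> FS a (I \<inter> {..<v})"
      using l(1) *(1)
      by (intro FS_add_disjoint[of t a "I \<inter> {..<l}" _ "I \<inter> {l..<n}"]) auto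
    then have "z \<in> FS a (I \<inter> {..<v})" using F(3) by (simp add: algebra_simps)
    then show False using *(3) by blast
  qed
  obtain M where M: "\<And>n z. z \<notin> FS a (I \<inter> {..<n}) \<Longrightarrow> N \<le> z \<Longrightarrow> z \<le> head n - M \<Longrightarrow>
    (\<exists>l s m. 0 \<le> s \<and> N \<le> a l \<and> a l + s \<notin> FS a (I \<inter> {..l}) \<and>
      m \<le> l \<and> (\<forall>p<m. \<forall>i. a i < a p + N \<longrightarrow> i < l) \<and> a l + s \<le> head m - K)"
    using descent_step[of 0 K] by blast
  show ?thesis
  proof (intro exI[of _ M] allI impI, rule ccontr)
    fix n z
    assume z: "N \<le> z" "z \<le> head n - M" "z \<notin> FS a (I \<inter> {..<n})"
    from M[OF z(3,1,2)] obtain l s m where lm: "0 \<le> s" "N \<le> a l"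
      "a l + s \<notin> FS a (I \<inter> {..l})" "m \<le> l"
      "\<forall>p<m. \<forall>i. a i < a p + N \<longrightarrow> i < l" "a l + s \<le> head m - K" by blast
    have "a l + s \<notin> FS a (I \<inter> {..<l})"
      using lm(3) FS_mono[of "a l + s" a "I \<inter> {..<l}" "I \<inter> {..l}"] by fastforce
    then show False using near_full[OF lm(4,5) _ _ lm(6)] lm(1,2) by simp
  qed
qed

end

section \<open>Deleting one more occurrence\<close>

text \<open>
  The index \<open>y\<close> is deleted together with an arbitrary companion. For large \<open>n\<close> the number \<open>a n - 1\<close>
  remains a sum, necessarily of terms before \<open>n\<close> without \<open>a y\<close>; hence all terms before \<open>n\<close> sum to
  at least \<open>a n - 1 + a y\<close>, of which \<open>D\<close> takes only a constant.
\<close>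

lemma head_exceeds_next_term:
  fixes a :: "nat \<Rightarrow> int"
  assumes "mono a" and pos: "\<And>i. 0 < a i" and unbounded: "\<And>K. \<exists>n. K \<le> a n"
    and two: "\<And>D. card D = 2 \<Longrightarrow> complete_seq a (UNIV - D)"
    and "finite D"
  shows "\<exists>p. \<forall>n\<ge>p. a n + K \<le> (\<Sum>i\<in>(UNIV - D) \<inter> {..<n}. a i)"
proof -
  have less_index: "i < j" if "a i < a j" for i j
    using that \<open>mono a\<close> by (metis leD leI monoD)
  define c where "c = (\<Sum>i\<in>D. a i)"
  obtain y where y: "K + c + 1 \<le> a y" using unbounded by blast
  have "complete_seq a (UNIV - {y, Suc y})" by (intro two) simp
  then obtain N where N: "\<And>x. N \<le> x \<Longrightarrow> x \<in> FS a (UNIV - {y, Suc y})"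
    unfolding complete_seq_def by blast
  obtain r where r: "N + 1 \<le> a r" using unbounded by blast
  show ?thesis
  proof (intro exI[of _ "max r (Suc y)"] allI impI)
    fix n assume n: "max r (Suc y) \<le> n"
    have "a r \<le> a n" using n \<open>mono a\<close> by (simp add: monoD)
    then have "N \<le> a n - 1" using r by linarith
    then obtain F where F: "finite F" "F \<subseteq> UNIV - {y, Suc y}" "a n - 1 = (\<Sum>i\<in>F. a i)"
      using N unfolding FS_def by blast
    have "i < n" if "i \<in> F" for i
    proof -
      have "a i \<le> (\<Sum>i\<in>F. a i)"
        using F(1) that pos by (intro member_le_sum) (auto simp: less_imp_le)
      then show ?thesis using F(3) less_index by fastforce
    qed
    then have sub: "insert y F \<subseteq> D \<union> ((UNIV - D) \<inter> {..<n})" using n by auto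
    have "a n - 1 + a y = (\<Sum>i\<in>insert y F. a i)"
      using F by (subst sum.insert) auto
    also have "\<dots> \<le> (\<Sum>i\<in>D \<union> ((UNIV - D) \<inter> {..<n}). a i)"
      using sub \<open>finite D\<close> pos by (intro sum_mono2) (auto simp: less_imp_le)
    also have "\<dots> = c + (\<Sum>i\<in>(UNIV - D) \<inter> {..<n}. a i)"
      unfolding c_def using \<open>finite D\<close> by (intro sum.union_disjoint) auto
    finally show "a n + K \<le> (\<Sum>i\<in>(UNIV - D) \<inter> {..<n}. a i)" using y by linarith
  qed
qed

text \<open>
  A representation of \<open>x - N\<close> without \<open>y\<close> and \<open>j\<close> may still use \<open>D\<close>, but only before \<open>j\<close>. That part
  falls short of the total before \<open>j\<close> by \<open>a y\<close>, so after adding \<open>N\<close> back it lies in the range where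
  the terms outside \<open>D\<close> before \<open>j\<close> represent everything.
\<close>

lemma delete_from_unbounded:
  fixes a :: "nat \<Rightarrow> int"
  assumes mono: "mono a" and pos: "\<And>i. 0 < a i" and unbounded: "\<And>K. \<exists>n. K \<le> a n"
    and two: "\<And>D. card D = 2 \<Longrightarrow> complete_seq a (UNIV - D)"
    and fin: "finite D" and compl: "complete_seq a (UNIV - D)"
  shows "\<exists>j. j \<notin> D \<and> complete_seq a (UNIV - insert j D)"
proof -
  obtain N0 where N0: "\<And>x. N0 \<le> x \<Longrightarrow> x \<in> FS a (UNIV - D)"
    using compl unfolding complete_seq_def by blast
  define N where "N = max N0 1"
  interpret slack_complete a "UNIV - D" N
    using mono pos unbounded N0 head_exceeds_next_term[OF mono pos unbounded two fin]
    by unfold_locales (auto simp: N_def)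
  obtain M where M: "\<And>n z. N \<le> z \<Longrightarrow> z \<le> head n - M \<Longrightarrow> z \<in> FS a ((UNIV - D) \<inter> {..<n})"
    using heads_full by blast
  define c where "c = (\<Sum>i\<in>D. a i)"
  obtain y where y: "c + N + M \<le> a y" using unbounded by blast
  obtain j where j: "\<forall>i\<in>insert y D. i < j"
    using fin finite_nat_set_iff_bounded[of "insert y D"] by auto
  have "complete_seq a (UNIV - {y, j})" using j by (intro two) auto
  then obtain R where R: "\<And>x. R \<le> x \<Longrightarrow> x \<in> FS a (UNIV - {y, j})"
    unfolding complete_seq_def by blast
  have "x \<in> FS a (UNIV - insert j D)" if "R + N \<le> x" for x
  proof -
    have "x - N \<in> FS a (UNIV - {y, j})" using R that by simp
    then obtain F where F: "finite F" "F \<subseteq> UNIV - {y, j}" "x - N = (\<Sum>i\<in>F. a i)"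
      by (rule FS_E)
    define g where "g = (\<Sum>i\<in>F \<inter> {..<j}. a i)"
    define f where "f = (\<Sum>i\<in>F \<inter> {j<..}. a i)"
    have "F = (F \<inter> {..<j}) \<union> (F \<inter> {j<..})" using F(2) by auto
    then have "(\<Sum>i\<in>F. a i) = (\<Sum>i\<in>(F \<inter> {..<j}) \<union> (F \<inter> {j<..}). a i)" by simp
    also have "\<dots> = g + f"
      unfolding g_def f_def using F(1) by (intro sum.union_disjoint) auto
    finally have gf: "x - N = g + f" using F(3) by simp
    have g0: "0 \<le> g" unfolding g_def using pos by (intro sum_nonneg) (simp add: less_imp_le)
    have "g + a y = (\<Sum>i\<in>insert y (F \<inter> {..<j}). a i)"
      unfolding g_def using F by (subst sum.insert) auto
    also have "\<dots> \<le> (\<Sum>i\<in>D \<union> ((UNIV - D) \<inter> {..<j}). a i)"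
      using j fin pos by (intro sum_mono2) (auto simp: less_imp_le)
    also have "\<dots> = c + head j"
      unfolding c_def head_def using fin by (intro sum.union_disjoint) auto
    finally have "g + N \<le> head j - M" using y by linarith
    then have "g + N \<in> FS a ((UNIV - D) \<inter> {..<j})" using M g0 by simp
    moreover have "f \<in> FS a {j<..}" unfolding f_def using F(1) by (intro FS_I) auto
    moreover have "{j<..} \<inter> D = {}" using j by auto
    ultimately have "g + N + f \<in> FS a (UNIV - insert j D)"
      by (intro FS_add_disjoint[of "g + N" a "(UNIV - D) \<inter> {..<j}" _ "{j<..}"]) auto
    then show ?thesis using gf by (simp add: algebra_simps)
  qed
  then have "complete_seq a (UNIV - insert j D)" unfolding complete_seq_def by blast
  moreover have "j \<notin> D" using j by auto
  ultimately show ?thesis by blast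
qed

lemma eventually_constant_if_bounded:
  fixes a :: "nat \<Rightarrow> int"
  assumes "mono a" and bound: "\<And>n. a n \<le> K"
  shows "\<exists>p. \<forall>n\<ge>p. a n = a p"
proof -
  obtain p where p: "\<And>n. nat (K - a p) \<le> nat (K - a n)"
    using ex_has_least_nat[of "\<lambda>_. True" 0 "\<lambda>n. nat (K - a n)"] by auto
  have "a n = a p" if "p \<le> n" for n
    using p[of n] bound[of n] bound[of p] monoD[OF \<open>mono a\<close> that] by linarith
  then show ?thesis by blast
qed

lemma delete_from_eventually_constant:
  fixes a :: "nat \<Rightarrow> int"
  assumes const: "\<And>n. p \<le> n \<Longrightarrow> a n = a p" and fin: "finite D"
    and compl: "complete_seq a (UNIV - D)"
  shows "\<exists>j. j \<notin> D \<and> complete_seq a (UNIV - insert j D)"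
proof -
  have fresh: "\<exists>j. p \<le> j \<and> j \<notin> E" if "finite E" for E
    using that infinite_Ici[of p] by (metis atLeast_iff finite_subset subsetI)
  obtain j where j: "p \<le> j" "j \<notin> D" using fresh[OF fin] by blast
  have "FS a (UNIV - D) \<subseteq> FS a (UNIV - insert j D)"
  proof
    fix x assume "x \<in> FS a (UNIV - D)"
    then obtain F where F: "finite F" "F \<subseteq> UNIV - D" "x = (\<Sum>i\<in>F. a i)" by (rule FS_E)
    show "x \<in> FS a (UNIV - insert j D)"
    proof (cases "j \<in> F")
      case False
      then show ?thesis using F FS_I[of F "UNIV - insert j D" a] by blast
    next
      case True
      obtain k where k: "p \<le> k" "k \<notin> insert j (D \<union> F)"
        using fresh[of "insert j (D \<union> F)"] fin F(1) by auto
      have "x = a j + (\<Sum>i\<in>F - {j}. a i)" using F True by (simp add: sum.remove)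
      also have "\<dots> = (\<Sum>i\<in>insert k (F - {j}). a i)"
        using F(1) k const[OF j(1)] const[OF k(1)] by (subst sum.insert) auto
      finally show ?thesis
        using FS_I[of "insert k (F - {j})" "UNIV - insert j D" a] F k by auto
    qed
  qed
  then show ?thesis using compl j(2) unfolding complete_seq_def by blast
qed

theorem proposition5:
  fixes a :: "nat \<Rightarrow> int"
  assumes nondecreasing: "mono a"
    and positive: "\<And>i. 0 < a i"
    and two_deletions: "\<And>D. card D = 2 \<Longrightarrow> complete_seq a (UNIV - D)"
  shows "(\<forall>D. finite D \<and> complete_seq a (UNIV - D) \<longrightarrow>
            (\<exists>j. j \<notin> D \<and> complete_seq a (UNIV - insert j D))) \<and>
         (\<forall>r. \<exists>D. finite D \<and> card D = r \<and> complete_seq a (UNIV - D))"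
proof -
  have extend: "\<exists>j. j \<notin> D \<and> complete_seq a (UNIV - insert j D)"
    if D: "finite D" "complete_seq a (UNIV - D)" for D
  proof (cases "\<forall>K. \<exists>n. K \<le> a n")
    case True
    then show ?thesis
      using delete_from_unbounded[OF nondecreasing positive _ two_deletions D] by blast
  next
    case False
    then obtain K where "\<And>n. a n \<le> K" by (meson linear)
    then obtain p where "\<And>n. p \<le> n \<Longrightarrow> a n = a p"
      using eventually_constant_if_bounded[OF nondecreasing] by blast
    then show ?thesis using delete_from_eventually_constant[OF _ D] by blast
  qed
  have "\<exists>D. finite D \<and> card D = r \<and> complete_seq a (UNIV - D)" for r
  proof (induction r)
    case 0
    have "complete_seq a (UNIV - {0, 1})" by (intro two_deletions) simp
    then have "complete_seq a (UNIV - {})" by (rule complete_seq_mono) simp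
    then show ?case by (intro exI[of _ "{}"]) simp
  next
    case (Suc r)
    then obtain D where "finite D" "card D = r" "complete_seq a (UNIV - D)" by blast
    then show ?case using extend by (metis card_insert_disjoint finite_insert)
  qed
  then show ?thesis using extend by blast
qed

end
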